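(* Let $k$ be an algebraically closed field of characteristic $0$. Then the affine variety $\Sigma_3$ is isomorphic to an affine line (over $k$).
   Context: For $A,B\subseteq k$, $A\le_p B$ means that there is a polynomial $P\in k[X]$ with $A=P^{-1}(B)$; $A\equiv_p B$ means $A\le_p B$ and $B\le_p A$; $[A]$ is the $\equiv_p$-class of $A$. $\mathcal P_n$ is the set of $n$-element subsets of $k$, and $\Sigma_n=\{[A]\mid A\in\mathcal P_n\}$. Two elements of $\mathcal P_n$ are $\equiv_p$-equivalent if and only if one is the image of the other under a linear polynomial $cX+c'$ with $c\neq 0$. Variety structures: let $f_n=\prod_{j\ne j'}(X_j-X_{j'})\in k[X_1,\ldots,X_n]$ and let $D(f_n)\subseteq k^n$ be the open set of points with pairwise distinct coordinates, an affine variety with ring of regular functions $k[X_1,\ldots,X_n]_{f_n}$. $\mathcal P_n$ is the affine variety obtained as the geometric quotient of $D(f_n)$ by the symmetric group $Sym_n$ permuting coordinates; its regular functions are the $Sym_n$-invariant regular functions on $D(f_n)$. $\Sigma_n$ is the affine variety obtained as the geometric quotient of $\mathcal P_n$ by the action $(P,A)\mapsto P(A)$ of the group of linear polynomials (under composition): it has the quotient topology, and its ring of regular functions $\Gamma(\Sigma_n)$ consists of the regular functions on $\mathcal P_n$ invariant under this action. Explicitly, $\Gamma(\Sigma_n)$ is the $k$-algebra of functions $[\{a_1,\ldots,a_n\}]\mapsto\frac{g(a_1,\ldots,a_n)}{(f_n(a_1,\ldots,a_n))^r}$ with $r\in\mathbb N$ and $g\in k[X_1,\ldots,X_n]$ symmetric,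 homogeneous of degree $n(n-1)r$ (or zero), and translation invariant (that is, $g(a_1+t,\ldots,a_n+t)=g(a_1,\ldots,a_n)$ for all $a_1,\ldots,a_n,t\in k$). *)

theory Defs
  imports "HOL-Analysis.Analysis" "HOL-Computational_Algebra.Polynomial"
begin

section \<open>Polynomial reducibility of subsets of a field\<close>

definition poly_le :: "'k::field set \<Rightarrow> 'k set \<Rightarrow> bool" where
  "poly_le A B \<longleftrightarrow> (\<exists>P :: 'k poly. A = poly P -` B)"

definition poly_equiv :: "'k::field set \<Rightarrow> 'k set \<Rightarrow> bool" where
  "poly_equiv A B \<longleftrightarrow> poly_le A B \<and> poly_le B A"

text \<open>The class is taken among all subsets of the field, as the relation is defined on all of them.\<close>

definition poly_class :: "'k::field set \<Rightarrow> 'k set set" where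
  "poly_class A = {B. poly_equiv A B}"

definition PP :: "nat \<Rightarrow> 'k::field set set" where
  "PP n = {A. finite A \<and> card A = n}"

definition Sigma_set :: "nat \<Rightarrow> 'k::field set set set" where
  "Sigma_set n = poly_class ` PP n"


section \<open>Spaces with regular functions\<close>

text \<open>
  An affine variety is recorded by the topology on its set of points (the point set is the
  \<open>topspace\<close>) together with its ring of globally regular functions; for affine varieties these data
  determine the local regular functions as well.  Regular functions are total functions in HOL, and
  only their values on the point set matter: each set \<open>Regular\<close> below contains with a function
  all functions that agree with it on the point set.
\<close>

record ('a, 'k) variety =
  Top :: "'a topology"
  Regular :: "('a \<Rightarrow> 'k) set"

definition variety_morphism ::
    "('a \<Rightarrow> 'b) \<Rightarrow> ('a, 'k) variety \<Rightarrow> ('b, 'k) variety \<Rightarrow> bool" where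
  "variety_morphism \<phi> X Y \<longleftrightarrow>
     continuous_map (Top X) (Top Y) \<phi> \<and> (\<forall>F \<in> Regular Y. F \<circ> \<phi> \<in> Regular X)"

definition variety_isomorphic :: "('a, 'k) variety \<Rightarrow> ('b, 'k) variety \<Rightarrow> bool" where
  "variety_isomorphic X Y \<longleftrightarrow>
     (\<exists>\<phi> \<psi>. variety_morphism \<phi> X Y \<and> variety_morphism \<psi> Y X \<and>
        (\<forall>x \<in> topspace (Top X). \<psi> (\<phi> x) = x) \<and> (\<forall>y \<in> topspace (Top Y). \<phi> (\<psi> y) = y))"

text \<open>
  The quotient of a variety along a surjection \<open>\<pi>\<close> of its point set onto \<open>S\<close>: quotient topology, and
  as regular functions those whose pullback along \<open>\<pi>\<close> is regular.  When the fibres of \<open>\<pi>\<close> are the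
  orbits of a group action, the pullbacks are exactly the invariant regular functions, so that
  this is the geometric quotient by the action.
\<close>

definition quotient_variety ::
    "('a \<Rightarrow> 'b) \<Rightarrow> 'b set \<Rightarrow> ('a, 'k) variety \<Rightarrow> ('b, 'k) variety" where
  "quotient_variety \<pi> S X =
     \<lparr>Top = topology (\<lambda>U. U \<subseteq> S \<and> openin (Top X) {x \<in> topspace (Top X). \<pi> x \<in> U}),
      Regular = {F. F \<circ> \<pi> \<in> Regular X}\<rparr>"


section \<open>Affine space\<close>

text \<open>Points of affine \<open>n\<close>-space are lists of length \<open>n\<close>; coordinates are counted from 0.\<close>

definition points :: "nat \<Rightarrow> 'k list set" where
  "points n = {a. length a = n}"

text \<open>
  The functions given by polynomials in \<open>n\<close> variables, i.e. the algebra generated by the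
  coordinate functions.
\<close>

inductive_set poly_fun :: "nat \<Rightarrow> ('k::comm_ring_1 list \<Rightarrow> 'k) set" for n :: nat where
  const: "(\<lambda>a. c) \<in> poly_fun n"
| coord: "i < n \<Longrightarrow> (\<lambda>a. a ! i) \<in> poly_fun n"
| add: "p \<in> poly_fun n \<Longrightarrow> q \<in> poly_fun n \<Longrightarrow> (\<lambda>a. p a + q a) \<in> poly_fun n"
| mult: "p \<in> poly_fun n \<Longrightarrow> q \<in> poly_fun n \<Longrightarrow> (\<lambda>a. p a * q a) \<in> poly_fun n"

definition zariski_open :: "nat \<Rightarrow> 'k::field list set \<Rightarrow> bool" where
  "zariski_open n U \<longleftrightarrow>
     (\<exists>E \<subseteq> poly_fun n. U = points n - {a \<in> points n. \<forall>p \<in> E. p a = 0})"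

definition affine_space :: "nat \<Rightarrow> ('k::field list, 'k) variety" where
  "affine_space n =
     \<lparr>Top = topology (zariski_open n),
      Regular = {F. \<exists>p \<in> poly_fun n. \<forall>a \<in> points n. F a = p a}\<rparr>"

abbreviation affine_line :: "('k::field list, 'k) variety" where
  "affine_line \<equiv> affine_space 1"


section \<open>The varieties of finite sets and of their classes\<close>

text \<open>The product is over ordered pairs of distinct indices.\<close>

definition disc_fun :: "nat \<Rightarrow> 'k::field list \<Rightarrow> 'k" where
  "disc_fun n a = (\<Prod>(i, j) \<in> {(i, j). i < n \<and> j < n \<and> i \<noteq> j}. a ! i - a ! j)"

definition disc_points :: "nat \<Rightarrow> 'k::field list set" where
  "disc_points n = {a \<in> points n. disc_fun n a \<noteq> 0}"

definition disc_variety :: "nat \<Rightarrow> ('k::field list, 'k) variety" where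
  "disc_variety n =
     \<lparr>Top = subtopology (Top (affine_space n)) (disc_points n),
      Regular = {F. \<exists>p \<in> poly_fun n. \<exists>r :: nat.
                      \<forall>a \<in> disc_points n. F a = p a / disc_fun n a ^ r}\<rparr>"

text \<open>
  The fibres of \<open>set\<close> on \<open>disc_points n\<close> are the orbits of the symmetric group permuting coordinates.
\<close>

definition PP_variety :: "nat \<Rightarrow> ('k::field set, 'k) variety" where
  "PP_variety n = quotient_variety set (PP n) (disc_variety n)"

text \<open>
  Over an algebraically closed field of characteristic 0 and for \<open>n \<ge> 1\<close>, the fibres of
  \<open>poly_class\<close> on \<open>PP n\<close> are the orbits of the group of linear polynomials \<open>cX + c'\<close> with \<open>c \<noteq> 0\<close>.
\<close>

definition Sigma_variety :: "nat \<Rightarrow> ('k::field set set, 'k) variety" where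
  "Sigma_variety n = quotient_variety poly_class (Sigma_set n) (PP_variety n)"


section \<open>The topologies above are well defined\<close>

lemma istopology_quotient:
  "istopology (\<lambda>U. U \<subseteq> S \<and> openin T {x \<in> topspace T. f x \<in> U})"
proof -
  have 1: "{x \<in> topspace T. f x \<in> U \<inter> V} = {x \<in> topspace T. f x \<in> U} \<inter> {x \<in> topspace T. f x \<in> V}"
    for U V by blast
  have 2: "{x \<in> topspace T. f x \<in> \<Union>K} = (\<Union>U \<in> K. {x \<in> topspace T. f x \<in> U})" for K
    by blast
  show ?thesis
    unfolding istopology_def
  proof (intro conjI allI impI)
    fix U V
    assume "U \<subseteq> S \<and> openin T {x \<in> topspace T. f x \<in> U}"
      and "V \<subseteq> S \<and> openin T {x \<in> topspace T. f x \<in> V}"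
    then show "openin T {x \<in> topspace T. f x \<in> U \<inter> V}"
      by (simp only: 1 openin_Int)
  next
    fix K
    assume "\<forall>U \<in> K. U \<subseteq> S \<and> openin T {x \<in> topspace T. f x \<in> U}"
    then show "openin T {x \<in> topspace T. f x \<in> \<Union>K}"
      by (subst 2) (blast intro: openin_Union)
  qed blast+
qed

lemma openin_quotient_variety:
  "openin (Top (quotient_variety f S X)) U \<longleftrightarrow>
     U \<subseteq> S \<and> openin (Top X) {x \<in> topspace (Top X). f x \<in> U}"
  by (simp add: quotient_variety_def istopology_quotient topology_inverse')

lemma topspace_quotient_variety:
  assumes "f ` topspace (Top X) \<subseteq> S"
  shows "topspace (Top (quotient_variety f S X)) = S"
proof -
  have "{x \<in> topspace (Top X). f x \<in> S} = topspace (Top X)"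
    using assms by blast
  then have "openin (Top (quotient_variety f S X)) S"
    by (simp add: openin_quotient_variety)
  then show ?thesis
    by (metis openin_quotient_variety openin_subset openin_topspace subset_antisym)
qed

lemma istopology_zariski: "istopology (zariski_open n :: 'k::field list set \<Rightarrow> bool)"
  unfolding istopology_def
proof (intro conjI allI impI)
  fix U V :: "'k list set"
  assume "zariski_open n U" "zariski_open n V"
  then obtain E F where E: "E \<subseteq> poly_fun n" "U = points n - {a \<in> points n. \<forall>p \<in> E. p a = 0}"
    and F: "F \<subseteq> poly_fun n" "V = points n - {a \<in> points n. \<forall>p \<in> F. p a = 0}"
    unfolding zariski_open_def by blast
  let ?G = "(\<lambda>(p, q) a. p a * q a) ` (E \<times> F)"
  have "?G \<subseteq> poly_fun n"
    using E(1) F(1) by (auto intro!: poly_fun.mult)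
  moreover have "U \<inter> V = points n - {a \<in> points n. \<forall>p \<in> ?G. p a = 0}"
  proof (rule set_eqI)
    fix a
    have "(\<forall>p \<in> ?G. p a = 0) \<longleftrightarrow> (\<forall>p \<in> E. \<forall>q \<in> F. p a * q a = 0)"
      by simp
    also have "\<dots> \<longleftrightarrow> (\<forall>p \<in> E. p a = 0) \<or> (\<forall>q \<in> F. q a = 0)"
      unfolding mult_eq_0_iff by blast
    finally show "a \<in> U \<inter> V \<longleftrightarrow> a \<in> points n - {a \<in> points n. \<forall>p \<in> ?G. p a = 0}"
      unfolding E(2) F(2) by auto
  qed
  ultimately show "zariski_open n (U \<inter> V)"
    unfolding zariski_open_def by blast
next
  fix K :: "'k list set set"
  assume K: "\<forall>U \<in> K. zariski_open n U"
  let ?E = "{p \<in> poly_fun n. \<exists>U \<in> K. {b \<in> points n. p b \<noteq> 0} \<subseteq> U}"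
  have eq: "a \<in> \<Union>K \<longleftrightarrow> a \<in> points n \<and> (\<exists>p \<in> ?E. p a \<noteq> 0)" for a
  proof
    assume "a \<in> \<Union>K"
    then obtain U where U: "U \<in> K" "a \<in> U"
      by blast
    then obtain E where E: "E \<subseteq> poly_fun n" "U = points n - {a \<in> points n. \<forall>p \<in> E. p a = 0}"
      using K unfolding zariski_open_def by blast
    from U(2) have a: "a \<in> points n" and "\<exists>p \<in> E. p a \<noteq> 0"
      unfolding E(2) by auto
    then obtain p where p: "p \<in> E" "p a \<noteq> 0"
      by blast
    have "{b \<in> points n. p b \<noteq> 0} \<subseteq> U"
      unfolding E(2) using p(1) by auto
    then have "p \<in> ?E"
      using p(1) E(1) U(1) by auto
    with a p(2) show "a \<in> points n \<and> (\<exists>p \<in> ?E. p a \<noteq> 0)"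
      by blast
  next
    assume "a \<in> points n \<and> (\<exists>p \<in> ?E. p a \<noteq> 0)"
    then show "a \<in> \<Union>K"
      by auto
  qed
  have "\<Union>K = points n - {a \<in> points n. \<forall>p \<in> ?E. p a = 0}"
  proof (rule set_eqI)
    show "a \<in> \<Union>K \<longleftrightarrow> a \<in> points n - {a \<in> points n. \<forall>p \<in> ?E. p a = 0}" for a
      unfolding eq by (cases "a \<in> points n") simp_all
  qed
  moreover have "?E \<subseteq> poly_fun n"
    by simp
  ultimately show "zariski_open n (\<Union>K)"
    unfolding zariski_open_def by (intro exI[of _ ?E] conjI)
qed

lemma openin_affine_space: "openin (Top (affine_space n)) U \<longleftrightarrow> zariski_open n U"
  by (simp add: affine_space_def istopology_zariski topology_inverse')

lemma topspace_affine_space: "topspace (Top (affine_space n :: ('k::field list, 'k) variety)) = points n"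
proof -
  have "zariski_open n (points n :: 'k list set)"
    unfolding zariski_open_def
    by (rule exI[of _ "{\<lambda>a. 1}"]) (auto intro: poly_fun.const)
  moreover have "zariski_open n U \<Longrightarrow> U \<subseteq> points n" for U :: "'k list set"
    unfolding zariski_open_def by blast
  ultimately show ?thesis
    by (metis openin_affine_space openin_subset openin_topspace subset_antisym)
qed

lemma topspace_disc_variety: "topspace (Top (disc_variety n)) = disc_points n"
  by (auto simp: disc_variety_def topspace_affine_space disc_points_def)

lemma disc_points_iff: "a \<in> disc_points n \<longleftrightarrow> length a = n \<and> distinct a"
proof -
  have "finite {(i, j). i < n \<and> j < n \<and> i \<noteq> j}"
    by (rule finite_subset[of _ "{..<n} \<times> {..<n}"]) auto
  then show ?thesis
    by (auto simp: disc_points_def points_def disc_fun_def distinct_conv_nth)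
qed

lemma topspace_PP_variety: "topspace (Top (PP_variety n)) = PP n"
  unfolding PP_variety_def
  by (rule topspace_quotient_variety)
    (auto simp: topspace_disc_variety disc_points_iff PP_def distinct_card)

lemma topspace_Sigma_variety: "topspace (Top (Sigma_variety n)) = Sigma_set n"
  unfolding Sigma_variety_def
  by (rule topspace_quotient_variety) (simp add: topspace_PP_variety Sigma_set_def)

end

theory Submission
  imports Defs
begin

text \<open>
  Every set of three elements is the image of some \<open>{0, 1, t}\<close>, with \<open>t \<noteq> 0\<close> and \<open>t \<noteq> 1\<close>, under a
  linear polynomial, and \<open>t\<close> is determined up to the anharmonic group generated by
  \<open>t \<mapsto> 1 - t\<close> and \<open>t \<mapsto> 1 / t\<close>. So \<open>\<Sigma>\<^sub>3\<close> is the quotient of the projective line without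
  \<open>0, 1, \<infinity>\<close> by this group. As for elliptic curves in Legendre form, the quotient map is, up to a
  constant factor, the \<open>j\<close>-invariant \<open>J t = (t\<^sup>2 - t + 1)\<^sup>3 / (t (t - 1))\<^sup>2\<close>, and its values fill the
  affine line.

  On points, \<open>J\<close> must separate the classes and take every value. A polynomial \<open>P\<close> of degree
  \<open>d \<ge> 1\<close> pulls a set of \<open>n\<close> points back to at least \<open>d n - (d - 1)\<close> points, because
  multiple points of its fibres are roots of \<open>P'\<close>. Hence equivalent sets of equal size \<open>n \<ge> 2\<close> differ
  by a linear polynomial (\<open>poly_le_imp_affine_image\<close>), and \<open>J\<close> does not change under linear polynomials
  because it is a symmetric, translation invariant expression of degree 0 in the three points. Conversely, \<open>J s = J t\<close> splits into six linear equations for \<open>s\<close>,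
  one for each element of the anharmonic group (\<open>poly_class_eq_iff_triple_inv\<close>). Clearing
  denominators in \<open>J t = j\<close> gives an equation of degree 6 in \<open>t\<close>, solvable over an algebraically
  closed field (\<open>legendre_inv_surj\<close>).

  On functions, polynomials in \<open>J\<close> are regular since \<open>J\<close> is a symmetric polynomial divided by the
  discriminant (\<open>triple_inv_regular\<close>). The main point is the converse,
  \<open>anharmonic_invariant_is_poly\<close>: a regular function, evaluated at \<open>{0, 1, t}\<close>, is a rational function
  of \<open>t\<close> with poles only at \<open>0, 1, \<infinity>\<close>, invariant under the anharmonic group. Its pole order
  at 0 is even, since \<open>t \<mapsto> t / (t - 1)\<close> fixes 0 with derivative \<open>-1\<close>; as \<open>J\<close> has a double pole
  there, subtracting multiples of powers of \<open>J\<close> removes the poles. What remains has no pole at all and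
  is constant.

  The topologies agree because a nonempty open set of classes contains the class of \<open>{0, 1, t}\<close> for all
  but finitely many \<open>t\<close>, being given by the nonvanishing of polynomials in \<open>t\<close>. Its image under \<open>J\<close>
  is therefore cofinite, and cofinite subsets of the line are open.
\<close>

section \<open>Polynomials determined by their values\<close>

lemma poly_eqI_cofinite:
  fixes p q :: "'k::{idom, ring_char_0} poly"
  assumes "finite S" and eq: "\<And>x. x \<notin> S \<Longrightarrow> poly p x = poly q x"
  shows "p = q"
proof (rule ccontr)
  assume "p \<noteq> q"
  then have "finite {x. poly (p - q) x = 0}"
    by (intro poly_roots_finite) simp
  moreover have "UNIV - S \<subseteq> {x. poly (p - q) x = 0}"
    using eq by auto
  ultimately have "finite (UNIV - S)"
    by (rule finite_subset[rotated])
  then show False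
    using \<open>finite S\<close> infinite_UNIV_char_0[where 'a = 'k] by simp
qed

lemma sum_order_eq_degree:
  fixes p :: "'k::alg_closed_field poly"
  assumes "p \<noteq> 0"
  shows "(\<Sum>a | poly p a = 0. order a p) = degree p"
proof -
  obtain A where A: "size A = degree p" "p = smult (lead_coeff p) (\<Prod>x\<in>#A. [:-x, 1:])"
    using alg_closed_imp_factorization[OF assms] by blast
  have "proots (\<Prod>x\<in>#A. [:-x, 1:]) = A"
  proof (induction A)
    case (add x A)
    have "(\<Prod>x\<in>#A. [:-x, 1:]) \<noteq> 0"
      by (auto simp: prod_mset_zero_iff)
    with add show ?case
      by (simp add: proots_mult del: mult_pCons_left)
  qed simp
  then have "proots p = A"
    using A(2) assms by (metis leading_coeff_0_iff proots_smult)
  then have "degree p = (\<Sum>a\<in>set_mset (proots p). count (proots p) a)"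
    using A(1) by (simp add: size_multiset_overloaded_eq)
  then show ?thesis
    using assms by simp
qed

section \<open>Polynomial reducibility between finite sets of the same size\<close>

text \<open>
  Let \<open>R\<close> be the monic polynomial with simple roots \<open>B\<close>. The composition \<open>R \<circ> P\<close> has degree
  \<open>d |B|\<close> with \<open>d = degree P\<close>, and its roots are the preimages of \<open>B\<close>. The multiplicity of a root
  exceeds 1 by its multiplicity in \<open>P'\<close>, and these excesses sum to at most \<open>degree P' = d - 1\<close>.
\<close>

lemma card_poly_vimage_ge:
  fixes P :: "'k::{alg_closed_field, field_char_0} poly"
  assumes "finite B" and deg: "degree P > 0"
  shows "degree P * card B + 1 \<le> card (poly P -` B) + degree P"
proof -
  define R where "R = (\<Prod>b\<in>B. [:-b, 1:])"
  define Q where "Q = pcompose R P"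
  have roots_R: "poly R x = 0 \<longleftrightarrow> x \<in> B" for x
    using \<open>finite B\<close> by (simp add: R_def poly_prod)
  have deg_R: "degree R = card B"
    unfolding R_def by (subst degree_prod_eq_sum_degree) simp_all
  have "R \<noteq> 0"
    using \<open>finite B\<close> by (simp add: R_def)
  have simple: "poly (pderiv R) b \<noteq> 0" if "b \<in> B" for b
  proof -
    have "R = [:-b, 1:] * (\<Prod>b'\<in>B - {b}. [:-b', 1:])"
      using that \<open>finite B\<close> by (simp add: R_def prod.remove)
    then have "poly (pderiv R) b = (\<Prod>b'\<in>B - {b}. b - b')"
      by (simp add: pderiv_mult poly_prod pderiv_pCons del: mult_pCons_left)
    then show ?thesis
      using \<open>finite B\<close> by simp
  qed
  have roots_Q: "{a. poly Q a = 0} = poly P -` B"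
    by (auto simp: Q_def poly_pcompose roots_R)
  have deg_Q: "degree Q = degree P * card B"
    by (simp add: Q_def degree_pcompose deg_R)
  have "Q \<noteq> 0"
    using \<open>R \<noteq> 0\<close> deg by (auto simp: Q_def pcompose_eq_0_iff)
  have "pderiv P \<noteq> 0"
    using deg by (simp add: pderiv_eq_0_iff)
  have order_Q: "order a Q \<le> Suc (order a (pderiv P))" if "a \<in> poly P -` B" for a
  proof -
    have dQ: "pderiv Q = pcompose (pderiv R) P * pderiv P"
      by (simp add: Q_def pderiv_pcompose)
    have nz: "poly (pcompose (pderiv R) P) a \<noteq> 0"
      using simple that by (simp add: poly_pcompose)
    then have "pderiv Q \<noteq> 0"
      using \<open>pderiv P \<noteq> 0\<close> by (auto simp: dQ)
    then have "order a (pderiv Q) = order a (pderiv P)"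
      using nz unfolding dQ by (simp add: order_mult order_0I)
    moreover have "poly Q a = 0"
      using that roots_Q by blast
    ultimately show ?thesis
      using order_pderiv[of Q a] \<open>Q \<noteq> 0\<close> by simp
  qed
  have fin: "finite (poly P -` B)"
    using poly_roots_finite[OF \<open>Q \<noteq> 0\<close>] roots_Q by simp
  have "degree P * card B = (\<Sum>a\<in>poly P -` B. order a Q)"
    using sum_order_eq_degree[OF \<open>Q \<noteq> 0\<close>] by (simp add: roots_Q deg_Q)
  also have "\<dots> \<le> (\<Sum>a\<in>poly P -` B. Suc (order a (pderiv P)))"
    by (intro sum_mono order_Q)
  also have "\<dots> = card (poly P -` B) + (\<Sum>a\<in>poly P -` B. order a (pderiv P))"
    by (simp add: sum_Suc)
  also have "(\<Sum>a\<in>poly P -` B. order a (pderiv P))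
      \<le> (\<Sum>a\<in>poly P -` B \<union> {a. poly (pderiv P) a = 0}. order a (pderiv P))"
    using fin poly_roots_finite[OF \<open>pderiv P \<noteq> 0\<close>] by (intro sum_mono2) auto
  also have "\<dots> = (\<Sum>a | poly (pderiv P) a = 0. order a (pderiv P))"
    using fin poly_roots_finite[OF \<open>pderiv P \<noteq> 0\<close>]
    by (intro sum.mono_neutral_right) (auto simp: order_0I)
  also have "\<dots> = degree P - 1"
    by (simp add: sum_order_eq_degree[OF \<open>pderiv P \<noteq> 0\<close>] degree_pderiv)
  finally show ?thesis
    using deg by linarith
qed

text \<open>
  With \<open>n\<close> the common cardinality and \<open>d\<close> the degree of the reducing polynomial, the bound above reads
  \<open>(d - 1) (n - 1) \<le> 0\<close>, which forces \<open>d = 1\<close>. Constant polynomials are excluded because their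
  preimages are empty or the infinite field.
\<close>

lemma poly_le_imp_affine_image:
  fixes A B :: "'k::{alg_closed_field, field_char_0} set"
  assumes "poly_le A B" and fin: "finite A" "finite B" and card: "card A = card B" "2 \<le> card A"
  obtains c d where "c \<noteq> 0" "B = (\<lambda>x. c * x + d) ` A"
proof -
  obtain P where A: "A = poly P -` B"
    using \<open>poly_le A B\<close> unfolding poly_le_def by blast
  have "degree P = 1"
  proof (cases "degree P = 0")
    case True
    then obtain e where "P = [:e:]"
      using degree_eq_zeroE by blast
    then have "A = {} \<or> A = UNIV"
      using A by (cases "e \<in> B") auto
    then show ?thesis
      using fin(1) card infinite_UNIV_char_0[where 'a = 'k] by auto
  next
    case False
    then have "degree P * card A + 1 \<le> card A + degree P"
      using card_poly_vimage_ge[OF fin(2), of P] A card(1) by simp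
    then have "(degree P - 1) * (card A - 1) \<le> 0"
      using False card(2) by (simp add: algebra_simps)
    then show ?thesis
      using False card(2) by simp
  qed
  then obtain d c where P: "P = [:d, c:]" "c \<noteq> 0"
    by (cases P) (auto elim!: degree_eq_zeroE split: if_splits)
  have "B = (\<lambda>x. c * x + d) ` A"
  proof (rule set_eqI)
    fix b
    have "b = c * ((b - d) / c) + d"
      using P(2) by simp
    then show "b \<in> B \<longleftrightarrow> b \<in> (\<lambda>x. c * x + d) ` A"
      unfolding A P(1) by (auto simp: algebra_simps intro!: image_eqI[where x = "(b - d) / c"])
  qed
  with P(2) show thesis
    by (rule that)
qed

lemma poly_le_refl: "poly_le A A"
  unfolding poly_le_def by (rule exI[of _ "[:0, 1:]"]) auto

lemma poly_le_trans:
  assumes "poly_le A B" "poly_le B C"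
  shows "poly_le A C"
proof -
  obtain P Q where "A = poly P -` B" "B = poly Q -` C"
    using assms unfolding poly_le_def by blast
  then have "A = poly (pcompose Q P) -` C"
    by (auto simp: poly_pcompose)
  then show ?thesis
    unfolding poly_le_def by blast
qed

lemma poly_class_eq_iff: "poly_class A = poly_class B \<longleftrightarrow> poly_equiv A B"
  unfolding poly_class_def poly_equiv_def set_eq_iff mem_Collect_eq
  by (metis poly_le_refl poly_le_trans)

lemma poly_class_affine_image:
  assumes "c \<noteq> 0"
  shows "poly_class ((\<lambda>x. c * x + d) ` A) = poly_class A"
proof -
  have "A = poly [:d, c:] -` ((\<lambda>x. c * x + d) ` A)"
    using assms by (auto simp: algebra_simps)
  moreover have "(\<lambda>x. c * x + d) ` A = poly [:- d / c, 1 / c:] -` A"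
  proof (rule set_eqI)
    fix b
    have "poly [:- d / c, 1 / c:] b = (b - d) / c"
      by (simp add: diff_divide_distrib)
    moreover have "b \<in> (\<lambda>x. c * x + d) ` A \<longleftrightarrow> (b - d) / c \<in> A"
      using assms by (auto intro!: rev_image_eqI[of "(b - d) / c"])
    ultimately show "b \<in> (\<lambda>x. c * x + d) ` A \<longleftrightarrow> b \<in> poly [:- d / c, 1 / c:] -` A"
      by simp
  qed
  ultimately show ?thesis
    unfolding poly_class_eq_iff poly_equiv_def poly_le_def by blast
qed

section \<open>The invariant of a three-element set\<close>

text \<open>
  The sum of squared differences and the product of differences over ordered pairs are symmetric and translation
  invariant, and for three points the cube of the first has the same degree 6 as the second. The
  constants are chosen so that the value at \<open>{0, 1, t}\<close> is \<open>legendre_inv t\<close>. A definition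
  on sets makes the invariance under permutations automatic.
\<close>

definition triple_inv :: "'k::field set \<Rightarrow> 'k" where
  "triple_inv A = - (((\<Sum>x\<in>A. \<Sum>y\<in>A. (x - y)\<^sup>2) / 4) ^ 3) / (\<Prod>x\<in>A. \<Prod>y\<in>A - {x}. x - y)"

definition legendre_inv :: "'k::field \<Rightarrow> 'k" where
  "legendre_inv t = (t\<^sup>2 - t + 1) ^ 3 / (t * (t - 1))\<^sup>2"

lemma triple_inv_affine_image:
  assumes "card A = 3" "c \<noteq> 0"
  shows "triple_inv ((\<lambda>x. c * x + d) ` A) = triple_inv A"
proof -
  let ?f = "\<lambda>x. c * x + d"
  have inj: "inj_on ?f X" for X
    using assms(2) by (auto simp: inj_on_def)
  have "finite A"
    using assms(1) card.infinite by fastforce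
  have num: "(\<Sum>x\<in>?f ` A. \<Sum>y\<in>?f ` A. (x - y)\<^sup>2) = c\<^sup>2 * (\<Sum>x\<in>A. \<Sum>y\<in>A. (x - y)\<^sup>2)"
    by (simp add: sum.reindex[OF inj] sum_distrib_left power_mult_distrib flip: right_diff_distrib)
  have "(\<Prod>x\<in>?f ` A. \<Prod>y\<in>?f ` A - {x}. x - y) = (\<Prod>x\<in>A. \<Prod>y\<in>?f ` A - {?f x}. ?f x - y)"
    by (simp add: prod.reindex[OF inj])
  also have "\<dots> = (\<Prod>x\<in>A. \<Prod>y\<in>?f ` (A - {x}). ?f x - y)"
    using assms(2) by (intro prod.cong refl) auto
  also have "\<dots> = (\<Prod>x\<in>A. \<Prod>y\<in>A - {x}. c * (x - y))"
    by (simp add: prod.reindex[OF inj] flip: right_diff_distrib)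
  also have "\<dots> = (\<Prod>x\<in>A. c\<^sup>2 * (\<Prod>y\<in>A - {x}. x - y))"
    using assms(1) \<open>finite A\<close> by (intro prod.cong refl) (simp add: prod.distrib)
  also have "\<dots> = c ^ 6 * (\<Prod>x\<in>A. \<Prod>y\<in>A - {x}. x - y)"
    using assms(1) by (simp add: prod.distrib flip: power_mult)
  finally have den: "(\<Prod>x\<in>?f ` A. \<Prod>y\<in>?f ` A - {x}. x - y) = \<dots>" .
  show ?thesis
    unfolding triple_inv_def num den using assms(2)
    by (simp add: power_mult_distrib power_divide flip: power_mult)
qed

lemma triple_inv_legendre:
  fixes t :: "'k::field_char_0"
  assumes "t \<noteq> 0" "t \<noteq> 1"
  shows "triple_inv {0, 1, t} = legendre_inv t"
proof -
  have num: "(\<Sum>x\<in>{0, 1, t}. \<Sum>y\<in>{0, 1, t}. (x - y)\<^sup>2) = 4 * (t\<^sup>2 - t + 1)"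
    using assms by (simp add: power2_eq_square algebra_simps)
  have "{0, 1, t} - {0} = {1, t}" "{0, 1, t} - {1} = {0, t}" "{0, 1, t} - {t} = {0, 1}"
    using assms by auto
  then have "(\<Prod>x\<in>{0, 1, t}. \<Prod>y\<in>{0, 1, t} - {x}. x - y) = - (t * (t - 1))\<^sup>2"
    using assms by (simp add: power2_eq_square algebra_simps)
  then show ?thesis
    unfolding triple_inv_def legendre_inv_def num nonzero_mult_div_cancel_left[OF zero_neq_numeral[symmetric]]
    by simp
qed

lemma legendre_in_PP: "t \<noteq> 0 \<Longrightarrow> t \<noteq> 1 \<Longrightarrow> {0, 1, t} \<in> PP 3"
  by (simp add: PP_def)

lemma legendre_form:
  assumes "A \<in> PP 3"
  obtains t c d where "t \<noteq> 0" "t \<noteq> 1" "c \<noteq> 0" "A = (\<lambda>x. c * x + d) ` {0, 1, t}"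
proof -
  obtain x y z where A: "A = {x, y, z}" "x \<noteq> y" "x \<noteq> z" "y \<noteq> z"
    using assms by (auto simp: PP_def card_3_iff)
  show thesis
    by (rule that[of "(z - x) / (y - x)" "y - x" x]) (use A in auto)
qed

text \<open>
  This equality and the next one say that the class of \<open>{0, 1, t}\<close> depends only on the orbit of \<open>t\<close> under the
  anharmonic group.
\<close>

lemma poly_class_legendre_reflect: "poly_class {0, 1, 1 - t} = poly_class {0, 1, t}"
proof -
  have "(\<lambda>x. - 1 * x + 1) ` {0, 1, t} = {0, 1, 1 - t}"
    by auto
  then show ?thesis
    using poly_class_affine_image[of "- 1" 1 "{0, 1, t}"] by simp
qed

lemma poly_class_legendre_inverse:
  assumes "t \<noteq> 0"
  shows "poly_class {0, 1, 1 / t} = poly_class {0, 1, t}"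
proof -
  have "(\<lambda>x. (1 / t) * x + 0) ` {0, 1, t} = {0, 1, 1 / t}"
    using assms by auto
  then show ?thesis
    using poly_class_affine_image[of "1 / t" 0 "{0, 1, t}"] assms by simp
qed

text \<open>
  The invariant has degree 6 as a rational function and is constant on the orbits of the anharmonic group,
  whose generic orbits have 6 elements. So the numerator of the difference of two
  values splits into the six factors that vanish on the translates of \<open>t\<close>.
\<close>

lemma legendre_inv_eq_imp:
  fixes s t :: "'k::field"
  assumes s: "s \<noteq> 0" "s \<noteq> 1" and t: "t \<noteq> 0" "t \<noteq> 1"
    and eq: "legendre_inv s = legendre_inv t"
  shows "s \<in> {t, 1 - t, 1 / t, 1 - 1 / t, 1 / (1 - t), 1 - 1 / (1 - t)}"
proof -
  have "(s\<^sup>2 - s + 1) ^ 3 * (t * (t - 1))\<^sup>2 = (t\<^sup>2 - t + 1) ^ 3 * (s * (s - 1))\<^sup>2"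
    using eq s t by (simp add: legendre_inv_def frac_eq_eq)
  then have "(s - t) * (s - (1 - t)) * (s * t - 1) * (s * t - (t - 1))
      * (s * (1 - t) - 1) * (s * (1 - t) + t) = 0"
    by algebra
  then consider "s = t" | "s = 1 - t" | "s * t = 1" | "s * t = t - 1" | "s * (1 - t) = 1"
    | "s * (1 - t) = - t"
    by (auto simp: eq_neg_iff_add_eq_0)
  then show ?thesis
    using t by cases (auto simp: field_simps)
qed

lemma poly_class_legendre_eqI:
  fixes s t :: "'k::field"
  assumes "s \<noteq> 0" "s \<noteq> 1" "t \<noteq> 0" "t \<noteq> 1" "legendre_inv s = legendre_inv t"
  shows "poly_class {0, 1, s} = poly_class {0, 1, t}"
  using legendre_inv_eq_imp[OF assms] assms(3,4)
    poly_class_legendre_reflect[of t] poly_class_legendre_inverse[of t]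
    poly_class_legendre_reflect[of "1 / t"] poly_class_legendre_inverse[of "1 - t"]
    poly_class_legendre_reflect[of "1 / (1 - t)"]
  by auto

lemma poly_class_eq_iff_triple_inv:
  fixes A B :: "'k::{alg_closed_field, field_char_0} set"
  assumes A: "A \<in> PP 3" and B: "B \<in> PP 3"
  shows "poly_class A = poly_class B \<longleftrightarrow> triple_inv A = triple_inv B"
proof
  assume "poly_class A = poly_class B"
  then have "poly_le A B"
    by (simp add: poly_class_eq_iff poly_equiv_def)
  then obtain c d where "c \<noteq> 0" "B = (\<lambda>x. c * x + d) ` A"
    by (rule poly_le_imp_affine_image) (use A B in \<open>auto simp: PP_def\<close>)
  then show "triple_inv A = triple_inv B"
    using A triple_inv_affine_image[of A c d] by (simp add: PP_def)
next
  assume eq: "triple_inv A = triple_inv B"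
  obtain s c d where s: "s \<noteq> 0" "s \<noteq> 1" "c \<noteq> 0" "A = (\<lambda>x. c * x + d) ` {0, 1, s}"
    using A by (rule legendre_form)
  obtain t c' d' where t: "t \<noteq> 0" "t \<noteq> 1" "c' \<noteq> 0" "B = (\<lambda>x. c' * x + d') ` {0, 1, t}"
    using B by (rule legendre_form)
  have "triple_inv A = legendre_inv s"
    unfolding s(4) using s(1-3) by (subst triple_inv_affine_image) (simp_all add: triple_inv_legendre)
  moreover have "triple_inv B = legendre_inv t"
    unfolding t(4) using t(1-3) by (subst triple_inv_affine_image) (simp_all add: triple_inv_legendre)
  ultimately have "poly_class {0, 1, s} = poly_class {0, 1, t}"
    using eq s t by (intro poly_class_legendre_eqI) simp_all
  then show "poly_class A = poly_class B"
    unfolding s(4) t(4) using s(3) t(3) by (simp only: poly_class_affine_image not_False_eq_True)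
qed

text \<open>
  A root \<open>t\<close> of \<open>(t\<^sup>2 - t + 1)\<^sup>3 - j (t (t - 1))\<^sup>2\<close> is automatically different from 0 and 1, where this
  polynomial has the value 1.
\<close>

lemma legendre_inv_surj:
  fixes j :: "'k::alg_closed_field"
  obtains t where "t \<noteq> 0" "t \<noteq> 1" "legendre_inv t = j"
proof -
  let ?P = "[:1, -1, 1:] ^ 3 - smult j ([:0, -1, 1:]\<^sup>2)"
  have "degree ?P = 6"
  proof -
    have "degree ([:1, -1, 1:] ^ 3 :: 'k poly) = 6"
      by (simp add: degree_power_eq)
    moreover have "degree (smult j ([:0, -1, 1:]\<^sup>2)) \<le> 4"
      by (rule order_trans[OF degree_smult_le]) (simp add: degree_power_eq)
    ultimately show ?thesis
      by (simp only: diff_conv_add_uminus) (subst degree_add_eq_left, simp_all)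
  qed
  then obtain t where t: "poly ?P t = 0"
    using alg_closed_imp_poly_has_root[of ?P] by auto
  then have eq: "(t\<^sup>2 - t + 1) ^ 3 = j * (t * (t - 1))\<^sup>2"
    by (simp add: poly_power power2_eq_square algebra_simps)
  then have "t \<noteq> 0" "t \<noteq> 1"
    by auto
  with eq show thesis
    by (intro that[of t]) (simp_all add: legendre_inv_def)
qed

section \<open>Invariants of the anharmonic group\<close>

text \<open>
  This extends the substitution \<open>t \<mapsto> t / (t - 1)\<close> to polynomials by clearing denominators, so that identities
  that hold outside finitely many points can be evaluated at 0, the fixed point of the substitution.
\<close>

lemma poly_moebius_denominator:
  fixes R :: "'k::field poly"
  obtains S K where "\<And>x. x \<noteq> 1 \<Longrightarrow> poly S x = (x - 1) ^ K * poly R (x / (x - 1))"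
proof -
  have "\<exists>S K. \<forall>x. x \<noteq> 1 \<longrightarrow> poly S x = (x - 1) ^ K * poly R (x / (x - 1))"
  proof (induction R)
    case 0
    show ?case
      by (rule exI[of _ 0]) simp
  next
    case (pCons c R)
    then obtain S K where SK: "\<And>x. x \<noteq> 1 \<Longrightarrow> poly S x = (x - 1) ^ K * poly R (x / (x - 1))"
      by blast
    have "poly (smult c ([:-1, 1:] ^ Suc K) + [:0, 1:] * S) x
        = (x - 1) ^ Suc K * poly (pCons c R) (x / (x - 1))" if "x \<noteq> 1" for x
      using that SK[OF that] by (simp add: poly_power algebra_simps) (simp add: field_simps)
    then show ?case
      by blast
  qed
  then show thesis
    using that by blast
qed

text \<open>
  An invariant function has no pole of odd order at 0: the substitution \<open>t \<mapsto> t / (t - 1)\<close> acts near 0 as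
  \<open>t \<mapsto> - t\<close> to first order and so changes the sign of the leading coefficient of an odd pole.
  That coefficient is \<open>- R 0\<close>. In polynomial terms, invariance says \<open>R (t / (t - 1)) (t - 1)\<^bsup>3 (2 n + 1)\<^esup> = R t\<close>,
  and at \<open>t = 0\<close> this reads \<open>- R 0 = R 0\<close>.
\<close>

lemma odd_pole_imp_root:
  fixes R :: "'k::field_char_0 poly"
  assumes h: "\<And>t. t \<noteq> 0 \<Longrightarrow> t \<noteq> 1 \<Longrightarrow> h t = poly R t / (t * (t - 1)) ^ (2 * n + 1)"
    and inv: "\<And>t. t \<noteq> 0 \<Longrightarrow> t \<noteq> 1 \<Longrightarrow> h (t / (t - 1)) = h t"
  shows "poly R 0 = 0"
proof -
  obtain S K where SK: "\<And>x. x \<noteq> 1 \<Longrightarrow> poly S x = (x - 1) ^ K * poly R (x / (x - 1))"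
    using poly_moebius_denominator[of R] by blast
  have rel: "poly R (t / (t - 1)) * (t - 1) ^ (3 * (2 * n + 1)) = poly R t"
    if t: "t \<noteq> 0" "t \<noteq> 1" for t
  proof -
    \<comment> \<open>With \<open>u = t / (t - 1)\<close>, the denominator \<open>t (t - 1)\<close> becomes \<open>u (u - 1) = t / (t - 1)\<^sup>2\<close>.\<close>
    let ?u = "t / (t - 1)" and ?m = "2 * n + 1"
    have u: "?u \<noteq> 0" "?u \<noteq> 1" "?u * (?u - 1) = t / (t - 1)\<^sup>2"
      using t by (auto simp: field_simps power2_eq_square)
    have "poly R ?u / (t / (t - 1)\<^sup>2) ^ ?m = poly R t / (t * (t - 1)) ^ ?m"
      using inv[OF t] h[OF t] h[OF u(1,2)] by (simp only: u(3))
    moreover have "(t * (t - 1)) ^ ?m = (t / (t - 1)\<^sup>2) ^ ?m * (t - 1) ^ (3 * ?m)"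
      unfolding power_mult power_mult_distrib[symmetric]
      using t by (simp add: power2_eq_square power3_eq_cube)
    moreover have "(t / (t - 1)\<^sup>2) ^ ?m \<noteq> 0" "(t - 1) ^ (3 * ?m) \<noteq> 0"
      using t by auto
    moreover have "x * W = y" if "x / D = y / (D * W)" "D \<noteq> 0" "W \<noteq> 0" for x y D W :: 'k
      using that by (simp add: field_simps)
    ultimately show ?thesis
      by metis
  qed
  have "S * [:-1, 1:] ^ (3 * (2 * n + 1)) = [:-1, 1:] ^ K * R"
  proof (rule poly_eqI_cofinite[of "{0, 1}"])
    fix t :: 'k
    assume "t \<notin> {0, 1}"
    then show "poly (S * [:-1, 1:] ^ (3 * (2 * n + 1))) t = poly ([:-1, 1:] ^ K * R) t"
      using SK[of t] rel[of t] by (simp only: poly_mult poly_power) (simp add: mult.assoc)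
  qed simp
  then have "poly (S * [:-1, 1:] ^ (3 * (2 * n + 1))) 0 = poly ([:-1, 1:] ^ K * R) 0"
    by (rule arg_cong)
  then have "- ((-1) ^ K * poly R 0) = (-1) ^ K * poly R 0"
    using SK[of 0] by (simp add: poly_power)
  then show ?thesis
    by simp
qed

lemma poly_reflect_roots:
  fixes P :: "'k::field_char_0 poly"
  assumes sym: "\<And>t. t \<noteq> 0 \<Longrightarrow> t \<noteq> 1 \<Longrightarrow> poly P (1 - t) = poly P t" and "poly P 0 = 0"
  obtains R where "P = [:0, -1, 1:] * R"
proof -
  have "pcompose P [:1, -1:] = P"
    by (rule poly_eqI_cofinite[of "{0, 1}"]) (use sym in \<open>auto simp: poly_pcompose\<close>)
  then have "poly P 1 = poly (pcompose P [:1, -1:]) 1"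
    by simp
  then have "poly P 1 = 0"
    using \<open>poly P 0 = 0\<close> by (simp add: poly_pcompose)
  obtain S where S: "P = [:0, 1:] * S"
    using \<open>poly P 0 = 0\<close> poly_eq_0_iff_dvd[of P 0] by (auto elim: dvdE)
  then have "poly S 1 = 0"
    using \<open>poly P 1 = 0\<close> by simp
  then obtain R where "S = [:-1, 1:] * R"
    using poly_eq_0_iff_dvd[of S 1] by (auto elim: dvdE)
  then have "P = ([:0, 1:] * [:-1, 1:]) * R"
    using S by (simp only: mult.assoc)
  then show thesis
    by (intro that[of R]) simp
qed

text \<open>
  Such a polynomial has no pole at infinity because it has none at 0. Formally, for \<open>P \<noteq> 0\<close> the reflected
  polynomial is \<open>X\<^bsup>d\<^esup> P\<close> with \<open>d = degree P\<close>, of degree \<open>2 d\<close>, although reflection does not raise the degree.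
\<close>

lemma poly_inverse_invariant_const:
  fixes P :: "'k::field_char_0 poly"
  assumes inv: "\<And>t. t \<noteq> 0 \<Longrightarrow> t \<noteq> 1 \<Longrightarrow> poly P (1 / t) = poly P t"
  shows "degree P = 0"
proof (cases "P = 0")
  case False
  have "reflect_poly P = monom 1 (degree P) * P"
    by (rule poly_eqI_cofinite[of "{0, 1}"])
      (use inv in \<open>auto simp: poly_reflect_poly_nz poly_monom inverse_eq_divide\<close>)
  then have "degree P + degree P = degree (reflect_poly P)"
    using False by (simp add: degree_mult_eq degree_monom_eq monom_eq_0_iff)
  then show ?thesis
    using degree_reflect_poly_le[of P] by simp
qed simp

lemma legendre_inv_reflect: "legendre_inv (1 - t) = legendre_inv t"
  by (simp add: legendre_inv_def power2_eq_square algebra_simps)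

lemma legendre_inv_inverse:
  assumes "t \<noteq> 0"
  shows "legendre_inv (1 / t) = legendre_inv t"
proof -
  have "(1 / t)\<^sup>2 - 1 / t + 1 = (t\<^sup>2 - t + 1) / t\<^sup>2" "1 / t * (1 / t - 1) = - (t * (t - 1)) / t ^ 3"
    using assms by (simp_all add: field_simps power2_eq_square power3_eq_cube)
  then show ?thesis
    using assms unfolding legendre_inv_def
    by (simp add: power_divide flip: power_mult)
qed

text \<open>
  The induction lowers the pole orders at 0 and 1, which agree by the symmetry \<open>t \<mapsto> 1 - t\<close>, by two at a time.
  The invariant \<open>J = legendre_inv\<close> satisfies \<open>J\<^bsup>m\<^esup> = (t\<^sup>2 - t + 1)\<^bsup>3 m\<^esup> / (t (t - 1))\<^bsup>2 m\<^esup>\<close> with numerator 1 at 0,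
  so subtracting \<open>P 0\<close> times this power makes the numerator vanish at 0 and 1. The pole order has then
  dropped to at most \<open>2 m - 1\<close>, hence to at most \<open>2 m - 2\<close> by \<open>odd_pole_imp_root\<close>.
\<close>

lemma anharmonic_invariant_is_poly:
  fixes P :: "'k::field_char_0 poly"
  assumes "\<And>t. t \<noteq> 0 \<Longrightarrow> t \<noteq> 1 \<Longrightarrow> h t = poly P t / (t * (t - 1)) ^ (2 * m)"
    and "\<And>t. t \<noteq> 0 \<Longrightarrow> t \<noteq> 1 \<Longrightarrow> h (1 - t) = h t"
    and "\<And>t. t \<noteq> 0 \<Longrightarrow> t \<noteq> 1 \<Longrightarrow> h (1 / t) = h t"
  shows "\<exists>Q. \<forall>t. t \<noteq> 0 \<longrightarrow> t \<noteq> 1 \<longrightarrow> h t = poly Q (legendre_inv t)"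
  using assms
proof (induction m arbitrary: h P)
  case 0
  have "degree P = 0"
  proof (rule poly_inverse_invariant_const)
    fix t :: 'k
    assume "t \<noteq> 0" "t \<noteq> 1"
    then show "poly P (1 / t) = poly P t"
      using 0(1)[of t] 0(1)[of "1 / t"] 0(3)[of t] by simp
  qed
  then obtain c where "P = [:c:]"
    using degree_eq_zeroE by blast
  then show ?case
    using 0(1) by (intro exI[of _ "[:c:]"]) simp
next
  case (Suc m)
  define g where "g t = h t - poly P 0 * legendre_inv t ^ Suc m" for t
  have g_reflect: "g (1 - t) = g t" and g_inverse: "g (1 / t) = g t" if "t \<noteq> 0" "t \<noteq> 1" for t
    using Suc.prems(2,3)[OF that] that by (simp_all add: g_def legendre_inv_reflect legendre_inv_inverse)
  \<comment> \<open>The substitution is \<open>t \<mapsto> 1 - t\<close> conjugated by \<open>t \<mapsto> 1 / t\<close>.\<close>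
  have g_moebius: "g (t / (t - 1)) = g t" if t: "t \<noteq> 0" "t \<noteq> 1" for t
  proof -
    have "t / (t - 1) = 1 / (1 - 1 / t)" "1 - 1 / t \<noteq> 0" "1 - 1 / t \<noteq> 1" "1 / t \<noteq> 0" "1 / t \<noteq> 1"
      using t by (auto simp: field_simps)
    then show ?thesis
      using g_inverse[of "1 - 1 / t"] g_reflect[of "1 / t"] g_inverse[of t] t by simp
  qed
  define P1 where "P1 = P - smult (poly P 0) ([:1, -1, 1:] ^ (3 * Suc m))"
  have g1: "g t = poly P1 t / (t * (t - 1)) ^ (2 * Suc m)" if t: "t \<noteq> 0" "t \<noteq> 1" for t
  proof -
    have "poly ([:1, -1, 1:] ^ (3 * Suc m)) t = (t\<^sup>2 - t + 1) ^ (3 * Suc m)"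
      by (simp add: poly_power power2_eq_square algebra_simps)
    moreover have "legendre_inv t ^ Suc m = (t\<^sup>2 - t + 1) ^ (3 * Suc m) / (t * (t - 1)) ^ (2 * Suc m)"
      unfolding legendre_inv_def power_divide power_mult ..
    ultimately show ?thesis
      unfolding g_def P1_def Suc.prems(1)[OF t] by (simp add: diff_divide_distrib del: power_Suc)
  qed
  have reflect_den: "(1 - t) * (1 - t - 1) = t * (t - 1)" for t :: 'k
    by (simp add: algebra_simps)
  have "poly P1 (1 - t) = poly P1 t" if t: "t \<noteq> 0" "t \<noteq> 1" for t
    using g1[of t] g1[of "1 - t", unfolded reflect_den] g_reflect[of t] t by simp
  moreover have "poly P1 0 = 0"
    by (simp add: P1_def poly_power)
  ultimately obtain R where R: "P1 = [:0, -1, 1:] * R"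
    by (rule poly_reflect_roots)
  have poly_den: "poly [:0, -1, 1:] t = t * (t - 1)" for t :: 'k
    by (simp add: algebra_simps)
  have g2: "g t = poly R t / (t * (t - 1)) ^ (2 * m + 1)" if t: "t \<noteq> 0" "t \<noteq> 1" for t
    using t unfolding g1[OF t] R poly_mult poly_den by simp
  have "poly R (1 - t) = poly R t" if t: "t \<noteq> 0" "t \<noteq> 1" for t
    using g2[of t] g2[of "1 - t", unfolded reflect_den] g_reflect[of t] t by simp
  moreover have "poly R 0 = 0"
    using g2 g_moebius by (rule odd_pole_imp_root)
  ultimately obtain P2 where P2: "R = [:0, -1, 1:] * P2"
    by (rule poly_reflect_roots)
  have g3: "g t = poly P2 t / (t * (t - 1)) ^ (2 * m)" if t: "t \<noteq> 0" "t \<noteq> 1" for t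
    using t unfolding g2[OF t] P2 poly_mult poly_den by simp
  obtain Q where Q: "\<And>t. t \<noteq> 0 \<Longrightarrow> t \<noteq> 1 \<Longrightarrow> g t = poly Q (legendre_inv t)"
    using Suc.IH[OF g3 g_reflect g_inverse] by blast
  have "h t = poly (Q + monom (poly P 0) (Suc m)) (legendre_inv t)" if "t \<noteq> 0" "t \<noteq> 1" for t
    using Q[OF that] by (simp add: g_def poly_monom algebra_simps)
  then show ?case
    by blast
qed

section \<open>Polynomial functions\<close>

lemma poly_fun_diff:
  assumes "p \<in> poly_fun n" "q \<in> poly_fun n"
  shows "(\<lambda>a. p a - q a) \<in> poly_fun n"
proof -
  have "(\<lambda>a. p a + (- 1) * q a) \<in> poly_fun n"
    by (intro poly_fun.intros assms)
  then show ?thesis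
    by simp
qed

lemma poly_fun_power: "p \<in> poly_fun n \<Longrightarrow> (\<lambda>a. p a ^ r) \<in> poly_fun n"
  by (induction r) (auto intro: poly_fun.intros)

lemma poly_fun_sum: "(\<And>i. i \<in> I \<Longrightarrow> p i \<in> poly_fun n) \<Longrightarrow> (\<lambda>a. \<Sum>i\<in>I. p i a) \<in> poly_fun n"
  by (induction I rule: infinite_finite_induct) (auto intro: poly_fun.intros)

lemma poly_fun_prod: "(\<And>i. i \<in> I \<Longrightarrow> p i \<in> poly_fun n) \<Longrightarrow> (\<lambda>a. \<Prod>i\<in>I. p i a) \<in> poly_fun n"
  by (induction I rule: infinite_finite_induct) (auto intro: poly_fun.intros)

lemma poly_fun_poly: "p \<in> poly_fun n \<Longrightarrow> (\<lambda>a. poly q (p a)) \<in> poly_fun n"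
  by (induction q) (auto intro: poly_fun.intros)

text \<open>
  Restricting a polynomial function to a polynomially parametrised curve gives a polynomial in the parameter;
  the curves needed are the line itself and \<open>t \<mapsto> [0, 1, t]\<close>.
\<close>

lemma poly_fun_curve:
  assumes "p \<in> poly_fun n" "length cs = n"
  obtains q where "\<And>t. p (map (\<lambda>c. poly c t) cs) = poly q t"
proof -
  from assms have "\<exists>q. \<forall>t. p (map (\<lambda>c. poly c t) cs) = poly q t"
  proof induction
    case (const c)
    show ?case
      by (rule exI[of _ "[:c:]"]) simp
  next
    case (coord i)
    then show ?case
      by (intro exI[of _ "cs ! i"]) simp
  next
    case (add p q)
    then show ?case
      by (metis poly_add)
  next
    case (mult p q)
    then show ?case
      by (metis poly_mult)
  qed
  then show thesis
    using that by blast
qed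

lemma disc_fun_poly_fun: "disc_fun n \<in> poly_fun n"
proof -
  have "(\<lambda>a. disc_fun n a) \<in> poly_fun n"
    unfolding disc_fun_def case_prod_beta
    by (intro poly_fun_prod poly_fun_diff poly_fun.coord) auto
  then show ?thesis
    by simp
qed

section \<open>Regular functions and open sets\<close>

lemma Regular_affine_space:
  "F \<in> Regular (affine_space n) \<longleftrightarrow> (\<exists>p\<in>poly_fun n. \<forall>a\<in>points n. F a = p a)"
  by (simp add: affine_space_def)

lemma Regular_Sigma_variety:
  "F \<in> Regular (Sigma_variety n) \<longleftrightarrow>
     (\<exists>p\<in>poly_fun n. \<exists>r. \<forall>a\<in>disc_points n. F (poly_class (set a)) = p a / disc_fun n a ^ r)"
  by (simp add: Sigma_variety_def PP_variety_def quotient_variety_def disc_variety_def)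

text \<open>
  This form describes open sets as unions of nonvanishing loci, which are easy to pull back.
\<close>

lemma zariski_open_iff:
  "zariski_open n U \<longleftrightarrow> (\<exists>E \<subseteq> poly_fun n. U = {a \<in> points n. \<exists>p\<in>E. p a \<noteq> 0})"
proof -
  have "points n - {a \<in> points n. \<forall>p\<in>E. p a = 0} = {a \<in> points n. \<exists>p\<in>E. p a \<noteq> 0}"
    for E :: "('a list \<Rightarrow> 'a) set"
    by blast
  then show ?thesis
    unfolding zariski_open_def by simp
qed

lemma openin_Sigma_variety:
  "openin (Top (Sigma_variety n)) U \<longleftrightarrow> U \<subseteq> Sigma_set n \<and>
     (\<exists>E \<subseteq> poly_fun n. {a \<in> disc_points n. poly_class (set a) \<in> U}
        = {a \<in> disc_points n. \<exists>p\<in>E. p a \<noteq> 0})"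
proof -
  have set_PP: "set a \<in> PP n" if "a \<in> disc_points n" for a :: "'a list"
    using that by (simp add: disc_points_iff PP_def distinct_card)
  have sub: "disc_points n \<subseteq> points n"
    by (auto simp: disc_points_def)
  have open_disc: "openin (Top (disc_variety n)) V \<longleftrightarrow>
      (\<exists>E \<subseteq> poly_fun n. V = {a \<in> disc_points n. \<exists>p\<in>E. p a \<noteq> 0})" for V :: "'a list set"
  proof -
    have "openin (Top (disc_variety n)) V \<longleftrightarrow>
      (\<exists>E \<subseteq> poly_fun n. V = {a \<in> points n. \<exists>p\<in>E. p a \<noteq> 0} \<inter> disc_points n)"
      unfolding disc_variety_def by (auto simp: openin_subtopology openin_affine_space zariski_open_iff)
    moreover have "{a \<in> points n. \<exists>p\<in>E. p a \<noteq> 0} \<inter> disc_points n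
        = {a \<in> disc_points n. \<exists>p\<in>E. p a \<noteq> 0}" for E :: "('a list \<Rightarrow> 'a) set"
      using sub by blast
    ultimately show ?thesis
      by simp
  qed
  have "{a \<in> disc_points n. set a \<in> {A \<in> PP n. poly_class A \<in> U}}
      = {a \<in> disc_points n. poly_class (set a) \<in> U}"
    using set_PP by auto
  then show ?thesis
    unfolding Sigma_variety_def PP_variety_def openin_quotient_variety
      topspace_quotient_variety topspace_disc_variety
      topspace_PP_variety[unfolded PP_variety_def] open_disc
    by auto
qed

lemma zariski_open_line_cofinite:
  fixes W :: "'k::field list set"
  assumes "W \<subseteq> points 1" "finite (points 1 - W)"
  shows "zariski_open 1 W"
proof -
  define p where "p a = (\<Prod>b\<in>points 1 - W. a ! 0 - b ! 0)" for a :: "'k list"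
  have "(\<lambda>a. p a) \<in> poly_fun 1"
    unfolding p_def by (intro poly_fun_prod poly_fun_diff poly_fun.intros) auto
  moreover have "a \<in> W \<longleftrightarrow> p a \<noteq> 0" if a: "a \<in> points 1" for a
  proof -
    have "a ! 0 = b ! 0 \<longleftrightarrow> a = b" if "b \<in> points 1" for b
      using a that by (auto simp: points_def length_Suc_conv)
    then show ?thesis
      using assms(2) a unfolding p_def by auto
  qed
  ultimately show ?thesis
    unfolding zariski_open_iff using assms(1) by (intro exI[of _ "{p}"]) auto
qed

text \<open>
  In coordinates the denominator of the invariant is exactly \<open>disc_fun 3\<close>, so the invariant is regular;
  regular functions form an algebra.
\<close>

lemma triple_inv_regular:
  fixes q :: "'k::field_char_0 poly"
  obtains p r where "p \<in> poly_fun 3"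
    "\<And>a. a \<in> disc_points 3 \<Longrightarrow> poly q (triple_inv (set a)) = p a / disc_fun 3 a ^ r"
proof -
  define num :: "'k list \<Rightarrow> 'k" where
    "num a = - (((\<Sum>i<3. \<Sum>j<3. (a ! i - a ! j)\<^sup>2) / 4) ^ 3)" for a
  have "(\<lambda>a. 0 - ((\<Sum>i<3. \<Sum>j<3. (a ! i - a ! j)\<^sup>2) * (1 / 4)) ^ 3) \<in> (poly_fun 3 :: ('k list \<Rightarrow> 'k) set)"
    by (intro poly_fun_diff poly_fun_power poly_fun.mult poly_fun_sum poly_fun.const poly_fun.coord) auto
  then have num_poly: "num \<in> poly_fun 3"
    by (simp add: num_def[abs_def])
  have inv: "triple_inv (set a) = num a / disc_fun 3 a" if "a \<in> disc_points 3" for a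
  proof -
    have a: "length a = 3" "distinct a"
      using that by (simp_all add: disc_points_iff)
    have inj: "inj_on ((!) a) X" if "X \<subseteq> {..<3}" for X
      using a that by (auto simp: inj_on_def nth_eq_iff_index_eq subset_iff)
    have set_a: "set a = (!) a ` {..<3}"
      using a(1) by (auto simp: set_conv_nth)
    have "(\<Sum>x\<in>set a. \<Sum>y\<in>set a. (x - y)\<^sup>2) = (\<Sum>i<3. \<Sum>j<3. (a ! i - a ! j)\<^sup>2)"
      unfolding set_a by (simp add: sum.reindex[OF inj])
    moreover have "(\<Prod>x\<in>set a. \<Prod>y\<in>set a - {x}. x - y) = disc_fun 3 a"
    proof -
      have "(\<Prod>x\<in>set a. \<Prod>y\<in>set a - {x}. x - y) = (\<Prod>i<3. \<Prod>y\<in>set a - {a ! i}. a ! i - y)"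
        unfolding set_a by (simp add: prod.reindex[OF inj])
      also have "\<dots> = (\<Prod>i<3. \<Prod>j\<in>{..<3} - {i}. a ! i - a ! j)"
      proof (rule prod.cong[OF refl])
        fix i :: nat
        assume "i \<in> {..<3}"
        then have "set a - {a ! i} = (!) a ` ({..<3} - {i})"
          unfolding set_a using inj_on_image_set_diff[OF inj[OF order_refl], of "{..<3}" "{i}"] by auto
        then show "(\<Prod>y\<in>set a - {a ! i}. a ! i - y) = (\<Prod>j\<in>{..<3} - {i}. a ! i - a ! j)"
          by (simp add: prod.reindex[OF inj])
      qed
      also have "\<dots> = disc_fun 3 a"
        unfolding disc_fun_def by (subst prod.Sigma) (auto intro!: prod.cong)
      finally show ?thesis .
    qed
    ultimately show ?thesis
      unfolding triple_inv_def num_def by simp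
  qed
  have "\<exists>p\<in>poly_fun 3. \<exists>r. \<forall>a\<in>disc_points 3. poly q (triple_inv (set a)) = p a / disc_fun 3 a ^ r"
  proof (induction q)
    case 0
    show ?case
      by (rule bexI[of _ "\<lambda>a. 0"]) (auto intro: poly_fun.const)
  next
    case (pCons c q)
    then obtain p r where p: "p \<in> poly_fun 3"
      and eq: "\<And>a. a \<in> disc_points 3 \<Longrightarrow> poly q (triple_inv (set a)) = p a / disc_fun 3 a ^ r"
      by blast
    have "(\<lambda>a. c * disc_fun 3 a ^ Suc r + num a * p a) \<in> poly_fun 3"
      by (intro poly_fun.add poly_fun.mult poly_fun.const poly_fun_power disc_fun_poly_fun num_poly p)
    moreover have "poly (pCons c q) (triple_inv (set a))
        = (c * disc_fun 3 a ^ Suc r + num a * p a) / disc_fun 3 a ^ Suc r"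
      if "a \<in> disc_points 3" for a
    proof -
      have "disc_fun 3 a \<noteq> 0"
        using that by (simp add: disc_points_def)
      then show ?thesis
        using eq[OF that] inv[OF that] by (simp add: add_divide_distrib)
    qed
    ultimately show ?case
      by (intro bexI[of _ "\<lambda>a. c * disc_fun 3 a ^ Suc r + num a * p a"] exI[of _ "Suc r"]) auto
  qed
  then show thesis
    using that by blast
qed

section \<open>The isomorphism\<close>

lemma poly_fun_legendre:
  assumes "p \<in> poly_fun 3"
  obtains q where "\<And>t. p [0, 1, t] = poly q t"
proof -
  obtain q where "\<And>t. p (map (\<lambda>c. poly c t) [0, 1, [:0, 1:]]) = poly q t"
    using poly_fun_curve[OF assms, of "[0, 1, [:0, 1:]]"] by auto
  then show thesis
    by (intro that[of q]) simp
qed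

text \<open>
  At \<open>[0, 1, t]\<close> the denominator \<open>disc_fun 3\<close> is \<open>- (t (t - 1))\<^sup>2\<close>, so a regular function on the
  classes becomes a rational function of \<open>t\<close> of the form that \<open>anharmonic_invariant_is_poly\<close> treats.
  It is invariant because \<open>t\<close>, \<open>1 - t\<close> and \<open>1 / t\<close> give the same class.
\<close>

lemma regular_Sigma3_is_poly:
  fixes F :: "'k::field_char_0 set set \<Rightarrow> 'k"
  assumes "F \<in> Regular (Sigma_variety 3)"
  obtains Q where "\<And>t. t \<noteq> 0 \<Longrightarrow> t \<noteq> 1 \<Longrightarrow> F (poly_class {0, 1, t}) = poly Q (legendre_inv t)"
proof -
  obtain p r where p: "p \<in> poly_fun 3"
    and F: "\<And>a. a \<in> disc_points 3 \<Longrightarrow> F (poly_class (set a)) = p a / disc_fun 3 a ^ r"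
    using assms unfolding Regular_Sigma_variety by blast
  obtain q where q: "\<And>t. p [0, 1, t] = poly q t"
    using poly_fun_legendre[OF p] by blast
  have disc: "disc_fun 3 [0, 1, t] = - (t * (t - 1))\<^sup>2" for t :: 'k
  proof -
    have "{(i, j). i < 3 \<and> j < 3 \<and> i \<noteq> j} = {(0, 1), (0, 2), (1, 0), (1, 2), (2, 0), (2, 1 :: nat)}"
      by (auto simp: numeral_3_eq_3 less_Suc_eq numeral_2_eq_2)
    then show ?thesis
      unfolding disc_fun_def by (simp add: power2_eq_square algebra_simps)
  qed
  have "\<exists>Q. \<forall>t. t \<noteq> 0 \<longrightarrow> t \<noteq> 1 \<longrightarrow> F (poly_class {0, 1, t}) = poly Q (legendre_inv t)"
  proof (rule anharmonic_invariant_is_poly)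
    fix t :: 'k
    assume t: "t \<noteq> 0" "t \<noteq> 1"
    have "F (poly_class {0, 1, t}) = poly q t / (- (t * (t - 1))\<^sup>2) ^ r"
      using F[of "[0, 1, t]"] t by (simp add: disc_points_iff q disc)
    also have "(- (t * (t - 1))\<^sup>2) ^ r = (- 1) ^ r * (t * (t - 1)) ^ (2 * r)"
      by (subst power_minus) (simp add: power_mult)
    also have "poly q t / \<dots> = poly (smult ((- 1) ^ r) q) t / (t * (t - 1)) ^ (2 * r)"
      by (cases "even r") simp_all
    finally show "F (poly_class {0, 1, t}) = \<dots>" .
    show "F (poly_class {0, 1, 1 - t}) = F (poly_class {0, 1, t})"
      by (simp add: poly_class_legendre_reflect)
    show "F (poly_class {0, 1, 1 / t}) = F (poly_class {0, 1, t})"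
      using t by (simp add: poly_class_legendre_inverse)
  qed
  then show thesis
    using that by blast
qed

theorem theorem20:
  shows "variety_isomorphic
           (Sigma_variety 3 :: ('k::{alg_closed_field, field_char_0} set set, 'k) variety)
           (affine_line :: ('k list, 'k) variety)"
proof -
  \<comment> \<open>Neither choice affects \<open>\<phi>\<close> and \<open>\<psi>\<close>: the invariant depends only on the class, and conversely.\<close>
  define rep :: "'k set set \<Rightarrow> 'k set" where
    "rep C = (SOME A. A \<in> PP 3 \<and> poly_class A = C)" for C
  define lam :: "'k \<Rightarrow> 'k" where
    "lam j = (SOME t. t \<noteq> 0 \<and> t \<noteq> 1 \<and> legendre_inv t = j)" for j
  define \<phi> :: "'k set set \<Rightarrow> 'k list" where "\<phi> C = [triple_inv (rep C)]" for C
  define \<psi> :: "'k list \<Rightarrow> 'k set set" where "\<psi> l = poly_class {0, 1, lam (l ! 0)}" for l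
  have \<phi>: "\<phi> (poly_class A) = [triple_inv A]" if "A \<in> PP 3" for A
  proof -
    have "rep (poly_class A) \<in> PP 3 \<and> poly_class (rep (poly_class A)) = poly_class A"
      unfolding rep_def by (rule someI[of _ A]) (simp add: that)
    then show ?thesis
      using poly_class_eq_iff_triple_inv that unfolding \<phi>_def by blast
  qed
  have lam: "lam j \<noteq> 0" "lam j \<noteq> 1" "legendre_inv (lam j) = j" for j
    unfolding lam_def by (rule legendre_inv_surj[of j], rule someI2, blast, blast)+
  have \<phi>\<psi>: "\<phi> (\<psi> l) = l" if "l \<in> points 1" for l
    using that lam by (auto simp: \<psi>_def \<phi> legendre_in_PP triple_inv_legendre points_def length_Suc_conv)
  have \<psi>_class: "\<psi> [triple_inv A] = poly_class A" if "A \<in> PP 3" for A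
    using that lam poly_class_eq_iff_triple_inv[of "{0, 1, lam (triple_inv A)}" A]
    by (simp add: \<psi>_def legendre_in_PP triple_inv_legendre)
  have \<psi>\<phi>: "\<psi> (\<phi> C) = C" if "C \<in> Sigma_set 3" for C
    using that by (auto simp: Sigma_set_def \<phi> \<psi>_class)
  have \<psi>_Sigma: "\<psi> l \<in> Sigma_set 3" for l
    using lam by (simp add: \<psi>_def Sigma_set_def legendre_in_PP)
  have set_PP: "set a \<in> PP 3" if "a \<in> disc_points 3" for a :: "'k list"
    using that by (simp add: disc_points_iff PP_def distinct_card)
  have pull: "\<exists>p'\<in>poly_fun 3. \<exists>r. \<forall>a\<in>disc_points 3. p (\<phi> (poly_class (set a))) = p' a / disc_fun 3 a ^ r"
    if p: "p \<in> poly_fun 1" for p :: "'k list \<Rightarrow> 'k"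
  proof -
    obtain q where "\<And>t. p (map (\<lambda>c. poly c t) [[:0, 1:]]) = poly q t"
      using poly_fun_curve[OF p, of "[[:0, 1:]]"] by auto
    then have q: "p [t] = poly q t" for t
      by simp
    obtain p' r where p': "p' \<in> poly_fun 3"
      "\<And>a. a \<in> disc_points 3 \<Longrightarrow> poly q (triple_inv (set a)) = p' a / disc_fun 3 a ^ r"
      using triple_inv_regular[of q] by blast
    have "p (\<phi> (poly_class (set a))) = p' a / disc_fun 3 a ^ r" if "a \<in> disc_points 3" for a
      using p'(2)[OF that] by (simp only: \<phi>[OF set_PP[OF that]] q)
    with p'(1) show ?thesis
      by blast
  qed
  have "variety_morphism \<phi> (Sigma_variety 3) (affine_space 1)"
    unfolding variety_morphism_def
  proof (intro conjI ballI)
    show "continuous_map (Top (Sigma_variety 3)) (Top (affine_space 1)) \<phi>"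
      unfolding continuous_map_def topspace_Sigma_variety topspace_affine_space
    proof (intro conjI allI impI)
      show "\<phi> \<in> Sigma_set 3 \<rightarrow> points 1"
        by (simp add: \<phi>_def points_def)
      fix U :: "'k list set"
      assume "openin (Top (affine_space 1)) U"
      then obtain E where E: "E \<subseteq> poly_fun 1" "U = {l \<in> points 1. \<exists>p\<in>E. p l \<noteq> 0}"
        by (auto simp: openin_affine_space zariski_open_iff)
      \<comment> \<open>The pullback of \<open>p\<close> is \<open>p' / disc\<^bsup>r\<^esup>\<close>, with the same zeros as its numerator; \<open>E'\<close> collects these numerators.\<close>
      define E' where "E' = {p' \<in> poly_fun 3. \<exists>p\<in>E. \<exists>r. \<forall>a\<in>disc_points 3.
          p (\<phi> (poly_class (set a))) = p' a / disc_fun 3 a ^ r}"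
      have "(\<exists>p\<in>E. p (\<phi> (poly_class (set a))) \<noteq> 0) \<longleftrightarrow> (\<exists>p'\<in>E'. p' a \<noteq> 0)"
        if a: "a \<in> disc_points 3" for a
      proof
        assume "\<exists>p\<in>E. p (\<phi> (poly_class (set a))) \<noteq> 0"
        then obtain p where p: "p \<in> E" "p (\<phi> (poly_class (set a))) \<noteq> 0"
          by blast
        obtain p' r where p': "p' \<in> poly_fun 3"
          "\<forall>a\<in>disc_points 3. p (\<phi> (poly_class (set a))) = p' a / disc_fun 3 a ^ r"
          using pull[of p] p(1) E(1) by blast
        then have "p' \<in> E'" "p' a \<noteq> 0"
          using p a unfolding E'_def by auto
        then show "\<exists>p'\<in>E'. p' a \<noteq> 0"
          by blast
      next
        assume "\<exists>p'\<in>E'. p' a \<noteq> 0"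
        then obtain p' p r where "p' a \<noteq> 0" "p \<in> E"
          "p (\<phi> (poly_class (set a))) = p' a / disc_fun 3 a ^ r"
          using a unfolding E'_def by blast
        moreover have "disc_fun 3 a \<noteq> 0"
          using a by (simp add: disc_points_def)
        ultimately show "\<exists>p\<in>E. p (\<phi> (poly_class (set a))) \<noteq> 0"
          by (intro bexI[of _ p]) simp_all
      qed
      moreover have "\<phi> C \<in> points 1" for C
        by (simp add: \<phi>_def points_def)
      moreover have "poly_class (set a) \<in> Sigma_set 3" if "a \<in> disc_points 3" for a :: "'k list"
        using set_PP[OF that] by (simp add: Sigma_set_def)
      ultimately have "{a \<in> disc_points 3. poly_class (set a) \<in> {C \<in> Sigma_set 3. \<phi> C \<in> U}}
          = {a \<in> disc_points 3. \<exists>p'\<in>E'. p' a \<noteq> 0}"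
        unfolding E(2) by auto
      moreover have "E' \<subseteq> poly_fun 3"
        by (auto simp: E'_def)
      ultimately show "openin (Top (Sigma_variety 3)) {C \<in> Sigma_set 3. \<phi> C \<in> U}"
        unfolding openin_Sigma_variety by blast
    qed
  next
    fix F :: "'k list \<Rightarrow> 'k"
    assume "F \<in> Regular (affine_space 1)"
    then obtain p where "p \<in> poly_fun 1" "\<And>l. l \<in> points 1 \<Longrightarrow> F l = p l"
      unfolding Regular_affine_space by blast
    then show "F \<circ> \<phi> \<in> Regular (Sigma_variety 3)"
      using pull[of p] unfolding Regular_Sigma_variety by (simp add: \<phi>_def points_def)
  qed
  moreover have "variety_morphism \<psi> (affine_space 1) (Sigma_variety 3)"
    unfolding variety_morphism_def
  proof (intro conjI ballI)
    show "continuous_map (Top (affine_space 1)) (Top (Sigma_variety 3)) \<psi>"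
      unfolding continuous_map_def topspace_Sigma_variety topspace_affine_space
    proof (intro conjI allI impI)
      show "\<psi> \<in> points 1 \<rightarrow> Sigma_set 3"
        by (simp add: \<psi>_Sigma)
      fix U :: "'k set set set"
      assume "openin (Top (Sigma_variety 3)) U"
      then obtain E where E: "E \<subseteq> poly_fun 3"
        and U: "{a \<in> disc_points 3. poly_class (set a) \<in> U} = {a \<in> disc_points 3. \<exists>p\<in>E. p a \<noteq> 0}"
        unfolding openin_Sigma_variety by (elim conjE exE) (rule that)
      have U_iff: "poly_class {0, 1, t} \<in> U \<longleftrightarrow> (\<exists>p\<in>E. p [0, 1, t] \<noteq> 0)" if "t \<noteq> 0" "t \<noteq> 1" for t
        using that set_eq_iff[THEN iffD1, OF U, rule_format, of "[0, 1, t]"]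
        by (simp add: disc_points_iff)
      show "openin (Top (affine_space 1)) {l \<in> points 1. \<psi> l \<in> U}"
      proof (cases "{l \<in> points 1. \<psi> l \<in> U} = {}")
        case False
        then obtain l0 where "\<psi> l0 \<in> U"
          by blast
        then obtain p where p: "p \<in> E" "p [0, 1, lam (l0 ! 0)] \<noteq> 0"
          using U_iff[OF lam(1,2), of "l0 ! 0"] unfolding \<psi>_def by blast
        obtain q where q: "\<And>t. p [0, 1, t] = poly q t"
          using poly_fun_legendre[OF subsetD[OF E p(1)]] by blast
        \<comment> \<open>A point outside the preimage of \<open>U\<close> has its parameter among the roots of \<open>q\<close>.\<close>
        have "finite {t. poly q t = 0}"
          using p(2) q by (intro poly_roots_finite) auto
        moreover have "points 1 - {l \<in> points 1. \<psi> l \<in> U} \<subseteq> (\<lambda>t. [legendre_inv t]) ` {t. poly q t = 0}"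
        proof
          fix l
          assume l: "l \<in> points 1 - {l \<in> points 1. \<psi> l \<in> U}"
          then have "poly q (lam (l ! 0)) = 0"
            using U_iff[of "lam (l ! 0)"] lam p(1) q unfolding \<psi>_def by auto
          moreover have "l = [legendre_inv (lam (l ! 0))]"
            using l lam(3) by (auto simp: points_def length_Suc_conv)
          ultimately show "l \<in> (\<lambda>t. [legendre_inv t]) ` {t. poly q t = 0}"
            by blast
        qed
        ultimately have "finite (points 1 - {l \<in> points 1. \<psi> l \<in> U})"
          by (meson finite_imageI finite_subset)
        then show ?thesis
          unfolding openin_affine_space by (intro zariski_open_line_cofinite) auto
      next
        case True
        show ?thesis
          unfolding True by (rule openin_empty)
      qed
    qed
  next
    fix F :: "'k set set \<Rightarrow> 'k"
    assume "F \<in> Regular (Sigma_variety 3)"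
    then obtain Q where Q: "\<And>t. t \<noteq> 0 \<Longrightarrow> t \<noteq> 1 \<Longrightarrow> F (poly_class {0, 1, t}) = poly Q (legendre_inv t)"
      using regular_Sigma3_is_poly[of F] by blast
    have "(\<lambda>l. poly Q (l ! 0)) \<in> poly_fun 1"
      by (intro poly_fun_poly poly_fun.coord) simp
    moreover have "(F \<circ> \<psi>) l = poly Q (l ! 0)" for l
      using Q lam by (simp add: \<psi>_def)
    ultimately show "F \<circ> \<psi> \<in> Regular (affine_space 1)"
      unfolding Regular_affine_space by (intro bexI[of _ "\<lambda>l. poly Q (l ! 0)"]) simp_all
  qed
  ultimately show ?thesis
    unfolding variety_isomorphic_def topspace_Sigma_variety topspace_affine_space
    using \<phi>\<psi> \<psi>\<phi> by blast
qed

end
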